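(* Let $G$ be a graph, $S\subseteq V(G)$, $F=V(G)\setminus S$, and suppose that $(G,S)$ is independent, i.e. (a) $F$ is an independent set of $G$; (b) every vertex of $F$ has exactly two neighbours in $S$; (c) for every vertex $v\in F$, its two neighbours in $S$ lie in a common biconnected component (block) of $G[S]$; and (d) $G[S\cup\{x\}]$ has no $K_4$ minor for every $x\in F$. Let $G^*(S)$ be the graph with vertex set $F$ in which $u,v\in F$ are adjacent if and only if $G[S\cup\{u,v\}]$ contains $K_4$ as a minor. Then a set $W\subseteq F$ satisfies "$G-W$ has no $K_4$ minor" if and only if $W$ is a vertex cover of $G^*(S)$.
   Context: Graphs are finite, undirected, loopless and may contain parallel edges. A block (biconnected component) of a graph is a maximal connected subgraph without a cut vertex. A vertex cover of a graph $H$ is a set of vertices meeting every edge of $H$.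
   Formalization: The formal theorem additionally assumes that G[S] has no K_4 minor; this follows from (d) when F is nonempty, and without it the claim fails for F empty (e.g. G = K_4, S = V(G), W empty). *)

theory Defs
  imports Main
begin

text \<open>
  Undirected multigraphs: edges are named objects, so that parallel edges are distinct elements of
  \<open>edges G\<close> with the same set of end vertices.
\<close>

record ('v, 'e) mgraph =
  verts :: "'v set"
  edges :: "'e set"
  ends :: "'e \<Rightarrow> 'v set"

definition multigraph :: "('v, 'e) mgraph \<Rightarrow> bool" where
  "multigraph G \<longleftrightarrow> finite (verts G) \<and> finite (edges G) \<and>
     (\<forall>e\<in>edges G. ends G e \<subseteq> verts G \<and> card (ends G e) = 2)"

definition adj :: "('v, 'e) mgraph \<Rightarrow> 'v \<Rightarrow> 'v \<Rightarrow> bool" where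
  "adj G u v \<longleftrightarrow> (\<exists>e\<in>edges G. ends G e = {u, v})"

definition neighbours :: "('v, 'e) mgraph \<Rightarrow> 'v \<Rightarrow> 'v set" where
  "neighbours G v = {u. adj G v u}"

text \<open>The values of \<open>ends\<close> outside the edge set carry no meaning and are not compared.\<close>

definition subgraph :: "('v, 'e) mgraph \<Rightarrow> ('v, 'e) mgraph \<Rightarrow> bool" where
  "subgraph H G \<longleftrightarrow> multigraph H \<and> verts H \<subseteq> verts G \<and> edges H \<subseteq> edges G \<and>
     (\<forall>e\<in>edges H. ends H e = ends G e)"

definition induced :: "('v, 'e) mgraph \<Rightarrow> 'v set \<Rightarrow> ('v, 'e) mgraph" where
  "induced G X =
     \<lparr>verts = verts G \<inter> X, edges = {e \<in> edges G. ends G e \<subseteq> X}, ends = ends G\<rparr>"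

definition delete_verts :: "('v, 'e) mgraph \<Rightarrow> 'v set \<Rightarrow> ('v, 'e) mgraph" where
  "delete_verts G X = induced G (verts G - X)"

definition connected_graph :: "('v, 'e) mgraph \<Rightarrow> bool" where
  "connected_graph G \<longleftrightarrow> verts G \<noteq> {} \<and> (\<forall>u\<in>verts G. \<forall>v\<in>verts G. (adj G)\<^sup>*\<^sup>* u v)"

text \<open>
  A cut vertex separates two other vertices of its component, i.e. its deletion increases the
  number of components. In particular graphs with at most two vertices have no cut vertex, so
  isolated vertices and bridges (with their ends) are blocks.
\<close>

definition cut_vertex :: "('v, 'e) mgraph \<Rightarrow> 'v \<Rightarrow> bool" where
  "cut_vertex G c \<longleftrightarrow> c \<in> verts G \<and>
     (\<exists>u\<in>verts G - {c}. \<exists>v\<in>verts G - {c}.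
        (adj G)\<^sup>*\<^sup>* u v \<and> \<not> (adj (delete_verts G {c}))\<^sup>*\<^sup>* u v)"

definition block :: "('v, 'e) mgraph \<Rightarrow> ('v, 'e) mgraph \<Rightarrow> bool" where
  "block G B \<longleftrightarrow>
     subgraph B G \<and> connected_graph B \<and> (\<nexists>c. cut_vertex B c) \<and>
     (\<forall>B'. subgraph B' G \<and> connected_graph B' \<and> (\<nexists>c. cut_vertex B' c) \<and> subgraph B B'
        \<longrightarrow> subgraph B' B)"

text \<open>
  \<open>H\<close> is a minor of \<open>G\<close>: contracting the disjoint connected branch sets \<open>\<phi> x\<close> of \<open>G\<close> and
  deleting all superfluous vertices and edges yields \<open>H\<close>, the edge \<open>e\<close> of \<open>H\<close> coming from the
  edge \<open>\<psi> e\<close> of \<open>G\<close>. Here \<open>H\<close> is loopless, so no edge of \<open>H\<close> comes from inside a branch set.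
\<close>

definition is_minor :: "('a, 'b) mgraph \<Rightarrow> ('v, 'e) mgraph \<Rightarrow> bool" where
  "is_minor H G \<longleftrightarrow>
     (\<exists>(\<phi> :: 'a \<Rightarrow> 'v set) (\<psi> :: 'b \<Rightarrow> 'e).
        (\<forall>x\<in>verts H. \<phi> x \<subseteq> verts G \<and> connected_graph (induced G (\<phi> x))) \<and>
        (\<forall>x\<in>verts H. \<forall>y\<in>verts H. x \<noteq> y \<longrightarrow> \<phi> x \<inter> \<phi> y = {}) \<and>
        inj_on \<psi> (edges H) \<and> \<psi> ` edges H \<subseteq> edges G \<and>
        (\<forall>e\<in>edges H. \<forall>x y. ends H e = {x, y} \<longrightarrow>
           (\<exists>u\<in>\<phi> x. \<exists>v\<in>\<phi> y. ends G (\<psi> e) = {u, v})))"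

definition complete_graph :: "nat \<Rightarrow> (nat, nat set) mgraph" where
  "complete_graph n =
     \<lparr>verts = {..<n}, edges = {e. e \<subseteq> {..<n} \<and> card e = 2}, ends = (\<lambda>e. e)\<rparr>"

abbreviation has_K4_minor :: "('v, 'e) mgraph \<Rightarrow> bool" where
  "has_K4_minor G \<equiv> is_minor (complete_graph 4) G"

definition independent_set :: "('v, 'e) mgraph \<Rightarrow> 'v set \<Rightarrow> bool" where
  "independent_set G X \<longleftrightarrow> X \<subseteq> verts G \<and> (\<forall>u\<in>X. \<forall>v\<in>X. \<not> adj G u v)"

definition vertex_cover :: "('v, 'e) mgraph \<Rightarrow> 'v set \<Rightarrow> bool" where
  "vertex_cover G C \<longleftrightarrow> C \<subseteq> verts G \<and> (\<forall>e\<in>edges G. ends G e \<inter> C \<noteq> {})"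

definition independent_pair :: "('v, 'e) mgraph \<Rightarrow> 'v set \<Rightarrow> bool" where
  "independent_pair G S \<longleftrightarrow>
     (let F = verts G - S in
        independent_set G F \<and>
        (\<forall>v\<in>F. card (neighbours G v \<inter> S) = 2) \<and>
        (\<forall>v\<in>F. \<exists>B. block (induced G S) B \<and> neighbours G v \<inter> S \<subseteq> verts B) \<and>
        (\<forall>x\<in>F. \<not> has_K4_minor (induced G (S \<union> {x}))))"

text \<open>The graph \<open>G\<^sup>*(S)\<close>; it is simple, so its edges are just pairs of vertices.\<close>

definition conflict_graph :: "('v, 'e) mgraph \<Rightarrow> 'v set \<Rightarrow> ('v, 'v set) mgraph" where
  "conflict_graph G S =
     \<lparr>verts = verts G - S,
      edges = {{u, v} | u v. u \<in> verts G - S \<and> v \<in> verts G - S \<and> u \<noteq> v \<and>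
                  has_K4_minor (induced G (S \<union> {u, v}))},
      ends = (\<lambda>e. e)\<rparr>"

end

theory Submission
  imports Defs
begin

text \<open>
  A vertex of \<open>F\<close> acts as a virtual edge between its two neighbours in \<open>S\<close>. If the virtual edge
  \<open>ab\<close> is not parallel to an edge, then \<open>a\<close> and \<open>b\<close>, lying in a common block, are joined by two
  internally disjoint paths with nonempty interiors; since adding \<open>ab\<close> creates no \<open>K\<^sub>4\<close> minor, these
  interiors lie in different components of the graph without \<open>a\<close> and \<open>b\<close>. Any virtual edge \<open>pq\<close>
  joining two such components would produce a \<open>K\<^sub>4\<close> minor together with \<open>ab\<close>. So, if there are no
  conflicting pairs, the graph with all virtual edges is a 2-sum along \<open>ab\<close>, and \<open>K\<^sub>4\<close> minors of a
  2-sum live on one side. Induction on the number of vertices, with \<open>ab\<close> turned into a real edge on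
  both sides, reduces to the case where all virtual edges are parallel to edges.
\<close>

subsection \<open>Branch sets and 2-sums\<close>

text \<open>Graphs are handled as symmetric adjacency relations without a vertex set. Parallel edges
  and isolated vertices are invisible this way, and neither matters for a \<open>K4\<close>
  minor.\<close>

definition within :: "('v \<times> 'v) set \<Rightarrow> 'v set \<Rightarrow> ('v \<times> 'v) set" where
  "within E X = E \<inter> X \<times> X"

definition touch :: "('v \<times> 'v) set \<Rightarrow> 'v set \<Rightarrow> 'v set \<Rightarrow> bool" where
  "touch E X Y \<longleftrightarrow> (\<exists>x\<in>X. \<exists>y\<in>Y. (x, y) \<in> E)"

definition conn :: "('v \<times> 'v) set \<Rightarrow> 'v set \<Rightarrow> bool" where
  "conn E X \<longleftrightarrow> X \<noteq> {} \<and> (\<forall>x\<in>X. \<forall>y\<in>X. (x, y) \<in> (within E X)\<^sup>*)"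

text \<open>The closure is reflexive, so \<open>x\<close> belongs to its component even if it is not
  in \<open>X\<close>; the component is then just the singleton of \<open>x\<close>.\<close>

definition component :: "('v \<times> 'v) set \<Rightarrow> 'v set \<Rightarrow> 'v \<Rightarrow> 'v set" where
  "component E X x = {y. (x, y) \<in> (within E X)\<^sup>*}"

definition K4_model :: "('v \<times> 'v) set \<Rightarrow> (nat \<Rightarrow> 'v set) \<Rightarrow> bool" where
  "K4_model E B \<longleftrightarrow> (\<forall>i<4. conn E (B i)) \<and>
     (\<forall>i<4. \<forall>j<4. i \<noteq> j \<longrightarrow> B i \<inter> B j = {} \<and> touch E (B i) (B j))"

definition K4 :: "('v \<times> 'v) set \<Rightarrow> bool" where
  "K4 E \<longleftrightarrow> (\<exists>B. K4_model E B)"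

definition both_ways :: "'v \<Rightarrow> 'v \<Rightarrow> ('v \<times> 'v) set" where
  "both_ways a b = {(a, b), (b, a)}"

text \<open>This is all that the argument retains of a common block. In this form the property
  passes to the two sides of a 2-sum, see \<open>inseparable_in_side\<close>.\<close>

definition inseparable :: "('v \<times> 'v) set \<Rightarrow> 'v \<Rightarrow> 'v \<Rightarrow> bool" where
  "inseparable E a b \<longleftrightarrow> a \<noteq> b \<and> (a, b) \<in> E\<^sup>* \<and>
     (\<forall>c. c \<noteq> a \<longrightarrow> c \<noteq> b \<longrightarrow> (a, b) \<in> (within E (- {c}))\<^sup>*)"

section \<open>Connected sets, touching sets and components\<close>

lemma within_mono: "E \<subseteq> E' \<Longrightarrow> X \<subseteq> X' \<Longrightarrow> within E X \<subseteq> within E' X'"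
  by (auto simp: within_def)

lemma sym_within: "sym E \<Longrightarrow> sym (within E X)"
  by (auto simp: within_def sym_def)

lemma sym_both_ways: "sym (both_ways a b)"
  by (auto simp: both_ways_def sym_def)

lemma within_rtrancl_mono:
  "(x, y) \<in> (within E X)\<^sup>* \<Longrightarrow> E \<subseteq> E' \<Longrightarrow> X \<subseteq> X' \<Longrightarrow> (x, y) \<in> (within E' X')\<^sup>*"
  by (rule subsetD[OF rtrancl_mono[OF within_mono]])

lemma sym_rtranclD: "sym E \<Longrightarrow> (x, y) \<in> E\<^sup>* \<Longrightarrow> (y, x) \<in> E\<^sup>*"
  using symD[OF sym_rtrancl] .

lemma touch_mono: "touch E X Y \<Longrightarrow> E \<subseteq> E' \<Longrightarrow> X \<subseteq> X' \<Longrightarrow> Y \<subseteq> Y' \<Longrightarrow> touch E' X' Y'"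
  unfolding touch_def by blast

lemma touch_sym: "sym E \<Longrightarrow> touch E X Y \<Longrightarrow> touch E Y X"
  unfolding touch_def by (meson symD)

lemma conn_mono: "conn E X \<Longrightarrow> E \<subseteq> E' \<Longrightarrow> conn E' X"
  unfolding conn_def by (meson within_rtrancl_mono order_refl)

lemma conn_singleton: "conn E {x}"
  by (simp add: conn_def)

lemma conn_pathD: "conn E X \<Longrightarrow> x \<in> X \<Longrightarrow> y \<in> X \<Longrightarrow> (x, y) \<in> (within E X)\<^sup>*"
  by (simp add: conn_def)

lemma connI:
  assumes "sym E" "a \<in> X" "\<And>x. x \<in> X \<Longrightarrow> (a, x) \<in> (within E X)\<^sup>*"
  shows "conn E X"
  unfolding conn_def
proof (intro conjI ballI)
  fix x y assume "x \<in> X" "y \<in> X"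
  then show "(x, y) \<in> (within E X)\<^sup>*"
    using sym_rtranclD[OF sym_within[OF assms(1)] assms(3)] assms(3) by (meson rtrancl_trans)
qed (use assms(2) in blast)

lemma conn_Un:
  assumes "sym E" "conn E X" "conn E Y" "X \<inter> Y \<noteq> {} \<or> touch E X Y"
  shows "conn E (X \<union> Y)"
proof -
  have X: "(x, y) \<in> (within E (X \<union> Y))\<^sup>*" if "x \<in> X" "y \<in> X" for x y
    using assms(2) that by (meson conn_def within_rtrancl_mono order_refl Un_upper1)
  have Y: "(x, y) \<in> (within E (X \<union> Y))\<^sup>*" if "x \<in> Y" "y \<in> Y" for x y
    using assms(3) that by (meson conn_def within_rtrancl_mono order_refl Un_upper2)
  obtain x y where xy: "x \<in> X" "y \<in> Y" "(x, y) \<in> (within E (X \<union> Y))\<^sup>*"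
  proof (cases "X \<inter> Y = {}")
    case True
    then obtain x y where "x \<in> X" "y \<in> Y" "(x, y) \<in> E"
      using assms(4) by (auto simp: touch_def)
    then show thesis
      using that by (auto simp: within_def intro!: r_into_rtrancl)
  next
    case False
    then show thesis using that by blast
  qed
  show ?thesis
  proof (rule connI[OF assms(1)])
    show "x \<in> X \<union> Y" using xy by blast
    fix z assume "z \<in> X \<union> Y"
    then show "(x, z) \<in> (within E (X \<union> Y))\<^sup>*"
      using X Y xy by (meson UnE rtrancl_trans)
  qed
qed

text \<open>A walk from inside \<open>C\<close> to the outside must cross the boundary. If
  \<open>C\<close> is a component, \<open>component_step\<close> forces the crossing edge to end in
  the removed part; this is how components are shown to touch separators.\<close>

lemma exit_edge:
  assumes "(y, w) \<in> (within E X)\<^sup>*" "y \<in> C" "w \<notin> C"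
  obtains z z' where "(z, z') \<in> E" "z \<in> C" "z' \<notin> C" "z \<in> X" "z' \<in> X"
proof -
  have "w \<in> C \<or> (\<exists>z z'. (z, z') \<in> E \<and> z \<in> C \<and> z' \<notin> C \<and> z \<in> X \<and> z' \<in> X)"
    using assms(1)
  proof induction
    case base
    then show ?case using assms(2) by blast
  next
    case (step u v)
    then show ?case by (auto simp: within_def)
  qed
  then show thesis using assms(3) that by blast
qed

lemma component_self: "x \<in> component E X x"
  by (simp add: component_def)

lemma component_subset: "x \<in> X \<Longrightarrow> component E X x \<subseteq> X"
  by (auto simp: component_def within_def elim: rtranclE)

lemma component_step:
  "z \<in> component E X x \<Longrightarrow> (z, w) \<in> E \<Longrightarrow> z \<in> X \<Longrightarrow> w \<in> X \<Longrightarrow> w \<in> component E X x"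
  unfolding component_def within_def by (auto intro: rtrancl_into_rtrancl)

lemma conn_component:
  assumes "sym E"
  shows "conn E (component E X x)"
proof (rule connI[OF assms component_self])
  fix y assume "y \<in> component E X x"
  then have "(x, y) \<in> (within E X)\<^sup>*" by (simp add: component_def)
  then show "(x, y) \<in> (within E (component E X x))\<^sup>*"
  proof induction
    case (step y z)
    then have "(x, z) \<in> (within E X)\<^sup>*" by (meson rtrancl.rtrancl_into_rtrancl)
    with step have "(y, z) \<in> within E (component E X x)"
      by (auto simp: within_def component_def)
    then show ?case using step.IH by (rule rtrancl_into_rtrancl[rotated])
  qed simp
qed

lemma conn_subset_component: "conn E Y \<Longrightarrow> Y \<subseteq> X \<Longrightarrow> y \<in> Y \<Longrightarrow> Y \<subseteq> component E X y"
  unfolding component_def by (blast dest: conn_pathD intro: within_rtrancl_mono)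

section \<open>Models of \<open>K4\<close> by branch sets\<close>

lemma K4_mono: "K4 E \<Longrightarrow> E \<subseteq> E' \<Longrightarrow> K4 E'"
  unfolding K4_def K4_model_def using conn_mono touch_mono[OF _ _ order_refl order_refl] by metis

text \<open>A singleton branch set touches another one, and a larger one has edges inside at each of
  its points. So branch sets stay among the actual vertices, although no vertex set confines
  them.\<close>

lemma K4_model_Field:
  assumes "K4_model E B" "i < 4"
  shows "B i \<subseteq> Field E"
proof
  fix x assume x: "x \<in> B i"
  show "x \<in> Field E"
  proof (cases "B i = {x}")
    case True
    obtain j :: nat where "j < 4" "i \<noteq> j"
      using that[of 0] that[of 1] by (cases "i = 0") auto
    then have "touch E (B i) (B j)" using assms by (simp add: K4_model_def)
    then show ?thesis using True by (auto simp: touch_def Field_def)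
  next
    case False
    then obtain y where "y \<in> B i" "y \<noteq> x" using x by blast
    then have "(x, y) \<in> (within E (B i))\<^sup>*" "x \<noteq> y"
      using assms x by (auto simp: K4_model_def dest!: conn_pathD)
    then show ?thesis
      by (auto simp: within_def Field_def elim: converse_rtranclE)
  qed
qed

lemma K4_modelI:
  assumes "sym E" "\<And>i. i < 4 \<Longrightarrow> conn E (B i)"
    and "\<And>i j. j < 4 \<Longrightarrow> i < j \<Longrightarrow> B i \<inter> B j = {} \<and> touch E (B i) (B j)"
  shows "K4_model E B"
  unfolding K4_model_def
proof (intro conjI allI impI)
  fix i j :: nat assume "i < 4" "j < 4" "i \<noteq> j"
  then have "i < j \<or> j < i" by linarith
  then show "B i \<inter> B j = {}" using assms(3) \<open>i < 4\<close> \<open>j < 4\<close> by blast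
  show "touch E (B i) (B j)" using \<open>i < j \<or> j < i\<close> assms(1,3) \<open>i < 4\<close> \<open>j < 4\<close>
    by (metis touch_sym)
qed (use assms in auto)

lemma K4I:
  assumes "sym E" "conn E A" "conn E B" "conn E C" "conn E D"
    and "A \<inter> B = {}" "A \<inter> C = {}" "A \<inter> D = {}" "B \<inter> C = {}" "B \<inter> D = {}" "C \<inter> D = {}"
    and "touch E A B" "touch E A C" "touch E A D" "touch E B C" "touch E B D" "touch E C D"
  shows "K4 E"
proof -
  let ?B = "\<lambda>i::nat. if i = 0 then A else if i = 1 then B else if i = 2 then C else D"
  have "K4_model E ?B"
  proof (rule K4_modelI[OF assms(1)])
    fix i j :: nat assume "j < 4" "i < j"
    then have "(i,j) \<in> {(0,1),(0,2),(0,3),(1,2),(1,3),(2,3)}" by auto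
    then show "?B i \<inter> ?B j = {} \<and> touch E (?B i) (?B j)"
      using assms by auto
  qed (use assms in auto)
  then show ?thesis by (auto simp: K4_def)
qed

text \<open>If the separation is left and re-entered, then through its two ends, which are adjacent.\<close>

lemma path_in_side:
  assumes sep: "E \<subseteq> A \<times> A \<union> B \<times> B" "A \<inter> B = {a, b}" "(a, b) \<in> E" "(b, a) \<in> E"
    and path: "(x, z) \<in> (within E X)\<^sup>*" and x: "x \<in> X \<inter> A"
  shows "(z \<in> A \<longrightarrow> (x, z) \<in> (within E (X \<inter> A))\<^sup>*) \<and>
         (z \<in> B \<longrightarrow> (\<exists>s\<in>{a, b} \<inter> X. (x, s) \<in> (within E (X \<inter> A))\<^sup>*))"
  using path
proof induction
  case base
  then show ?case using x sep(2) by blast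
next
  case (step z z')
  let ?R = "within E (X \<inter> A)"
  have z: "(z, z') \<in> E" "z \<in> X" "z' \<in> X" using step by (auto simp: within_def)
  then consider "z \<in> A" "z' \<in> A" | "z \<in> B" "z' \<in> B" using sep(1) by blast
  then show ?case
  proof cases
    case 1
    then have "(x, z') \<in> ?R\<^sup>*"
      using step.IH z by (auto simp: within_def intro: rtrancl_into_rtrancl)
    then show ?thesis using 1 z sep(2) by blast
  next
    case 2
    \<comment> \<open>On the side \<open>B\<close> only a separator vertex \<open>s\<close> is
      remembered that was already reached within \<open>A\<close>.\<close>
    then obtain s where s: "s \<in> {a, b} \<inter> X" "(x, s) \<in> ?R\<^sup>*" using step.IH by blast
    have "(x, z') \<in> ?R\<^sup>*" if "z' \<in> A"
    proof -
      have "z' \<in> {a, b}" using that 2 sep(2) by blast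
      then have "s = z' \<or> (s, z') \<in> ?R"
        using s z sep by (auto simp: within_def)
      then show ?thesis using s by (auto intro: rtrancl_into_rtrancl)
    qed
    then show ?thesis using s by blast
  qed
qed

text \<open>Intersecting all branch sets with \<open>A\<close> keeps a model. Each of them meets
  \<open>A\<close>, because it equals or touches \<open>M i\<close>, whose neighbours all lie in
  \<open>A\<close>. Detours through \<open>B\<close> use \<open>a\<close> and \<open>b\<close> and
  are cut short by the edge \<open>ab\<close>.\<close>

lemma K4_two_sum_side:
  assumes sep: "E \<subseteq> A \<times> A \<union> B \<times> B" "A \<inter> B = {a, b}" "(a, b) \<in> E" "(b, a) \<in> E"
    and "K4_model E M" "i < 4" "M i \<subseteq> A - B"
  shows "K4 (within E A)"
proof -
  have conn: "conn E (M j)" if "j < 4" for j using assms(5) that by (simp add: K4_model_def)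
  have ne: "M j \<inter> A \<noteq> {}" if "j < 4" for j
  proof (cases "j = i")
    case True
    then show ?thesis using conn[OF \<open>i < 4\<close>] assms(7) by (auto simp: conn_def)
  next
    case False
    then have "touch E (M i) (M j)" using assms(5,6) that by (simp add: K4_model_def)
    then show ?thesis using assms(7) sep(1) by (fastforce simp: touch_def)
  qed
  have ab: "M j \<inter> {a, b} \<noteq> {}" if "j < 4" "z \<in> M j" "z \<in> B" for j z
  proof -
    from ne[OF that(1)] obtain x where "x \<in> M j \<inter> A" by blast
    then show ?thesis
      using path_in_side[OF sep conn_pathD[OF conn[OF that(1)] _ that(2)], of x] that by blast
  qed
  have "K4_model (within E A) (\<lambda>j. M j \<inter> A)"
    unfolding K4_model_def
  proof (intro conjI allI impI)
    fix j :: nat assume j: "j < 4"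
    show "conn (within E A) (M j \<inter> A)"
      unfolding conn_def
    proof (intro conjI ballI)
      fix x y assume xy: "x \<in> M j \<inter> A" "y \<in> M j \<inter> A"
      have "within (within E A) (M j \<inter> A) = within E (M j \<inter> A)"
        by (auto simp: within_def)
      then show "(x, y) \<in> (within (within E A) (M j \<inter> A))\<^sup>*"
        using path_in_side[OF sep conn_pathD[OF conn[OF j], of x y]] xy by auto
    qed (rule ne[OF j])
  next
    fix j k :: nat assume jk: "j < 4" "k < 4" "j \<noteq> k"
    then have disj: "M j \<inter> M k = {}" and "touch E (M j) (M k)"
      using assms(5) by (auto simp: K4_model_def)
    then show "(M j \<inter> A) \<inter> (M k \<inter> A) = {}" by blast
    obtain x y where xy: "x \<in> M j" "y \<in> M k" "(x, y) \<in> E"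
      using \<open>touch E (M j) (M k)\<close> by (auto simp: touch_def)
    show "touch (within E A) (M j \<inter> A) (M k \<inter> A)"
    proof (cases "x \<in> A \<and> y \<in> A")
      case True
      then show ?thesis using xy by (auto simp: touch_def within_def)
    next
      case False
      \<comment> \<open>The touching edge lies in \<open>B\<close> and is lost. The two branch sets
        contain different ends of the edge \<open>ab\<close>, which replaces it.\<close>
      then have "x \<in> B" "y \<in> B" using xy sep(1) by auto
      then obtain s t where "s \<in> M j \<inter> {a, b}" "t \<in> M k \<inter> {a, b}"
        using ab jk xy by blast
      moreover then have "s \<noteq> t" using disj by blast
      ultimately show ?thesis using sep by (auto simp: touch_def within_def)
    qed
  qed
  then show ?thesis by (auto simp: K4_def)
qed

text \<open>Two of the four branch sets avoid the two-vertex separator; they touch, so they lie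
  on the same side.\<close>

lemma K4_two_sum:
  assumes sep: "E \<subseteq> A \<times> A \<union> B \<times> B" "A \<inter> B = {a, b}" "(a, b) \<in> E" "(b, a) \<in> E"
    and "K4 E"
  shows "K4 (within E A) \<or> K4 (within E B)"
proof -
  obtain M where M: "K4_model E M" using assms(5) by (auto simp: K4_def)
  obtain i where i: "i < 4" "a \<notin> M i" "b \<notin> M i"
  proof -
    \<comment> \<open>Three pairwise disjoint branch sets cannot each contain one of only two
      vertices.\<close>
    have "\<exists>i<4. a \<notin> M i \<and> b \<notin> M i"
    proof (rule ccontr)
      assume H: "\<not> ?thesis"
      have D: "M 0 \<inter> M 1 = {}" "M 0 \<inter> M 2 = {}" "M 1 \<inter> M 2 = {}"
        using M by (simp_all add: K4_model_def)
      moreover have "a \<in> M i \<or> b \<in> M i" if "i < 4" for i using H that by blast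
      note this[of 0] this[of 1] this[of 2]
      ultimately show False by auto
    qed
    then show thesis using that by blast
  qed
  have conn: "conn E (M i)" using M i by (simp add: K4_model_def)
  then obtain x where x: "x \<in> M i" by (auto simp: conn_def)
  then have "x \<in> Field E" using K4_model_Field[OF M i(1)] by blast
  then have "x \<in> A \<or> x \<in> B" using sep(1) by (auto simp: Field_def)
  then show ?thesis
  proof
    assume xA: "x \<in> A"
    \<comment> \<open>A connected set avoiding \<open>a\<close> and \<open>b\<close> cannot change
      sides.\<close>
    have "M i \<subseteq> A - B"
    proof
      fix z assume "z \<in> M i"
      then have p: "(x, z) \<in> (within E (M i))\<^sup>*" using conn x by (simp add: conn_def)
      have "z \<in> A \<union> B" using K4_model_Field[OF M i(1)] \<open>z \<in> M i\<close> sep(1)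
        by (fastforce simp: Field_def)
      then show "z \<in> A - B" using path_in_side[OF sep p] x xA i by blast
    qed
    then show ?thesis using K4_two_sum_side[OF sep M i(1)] by blast
  next
    assume xB: "x \<in> B"
    have sep': "E \<subseteq> B \<times> B \<union> A \<times> A" "B \<inter> A = {a, b}" using sep by auto
    have "M i \<subseteq> B - A"
    proof
      fix z assume "z \<in> M i"
      then have p: "(x, z) \<in> (within E (M i))\<^sup>*" using conn x by (simp add: conn_def)
      have "z \<in> A \<union> B" using K4_model_Field[OF M i(1)] \<open>z \<in> M i\<close> sep(1)
        by (fastforce simp: Field_def)
      then show "z \<in> B - A" using path_in_side[OF sep' sep(3,4) p] x xB i by blast
    qed
    then show ?thesis using K4_two_sum_side[OF sep' sep(3,4) M i(1)] by blast
  qed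
qed

lemma conn_replace_edge:
  assumes "sym E'" "E \<subseteq> E'" "conn (E \<union> both_ways a b) X"
    and Y: "conn E' Y" "touch E' Y {a}" "touch E' Y {b}" and "a \<in> X"
  shows "conn E' (X \<union> Y)"
proof (rule connI[OF assms(1)])
  let ?R = "within E' (X \<union> Y)"
  show "a \<in> X \<union> Y" using assms by blast
  have aY: "conn E' (Y \<union> {a})" "conn E' (Y \<union> {b})"
    using conn_Un[OF assms(1) Y(1) conn_singleton] Y by auto
  have "Y \<noteq> {}" using Y(1) by (simp add: conn_def)
  then have abY: "conn E' ((Y \<union> {a}) \<union> (Y \<union> {b}))"
    using conn_Un[OF assms(1) aY] by blast
  have ab: "(a, b) \<in> ?R\<^sup>*" "(b, a) \<in> ?R\<^sup>*" if "b \<in> X"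
  proof -
    have "(Y \<union> {a}) \<union> (Y \<union> {b}) \<subseteq> X \<union> Y" using that \<open>a \<in> X\<close> by blast
    note mono = within_rtrancl_mono[OF _ order_refl this]
    show "(a, b) \<in> ?R\<^sup>*" "(b, a) \<in> ?R\<^sup>*"
      by (rule mono[OF conn_pathD[OF abY]]; simp)+
  qed
  have X: "(a, x) \<in> ?R\<^sup>*" if "x \<in> X" for x
  proof -
    have "(a, x) \<in> (within (E \<union> both_ways a b) X)\<^sup>*"
      using assms that by (simp add: conn_def)
    then show ?thesis
    proof induction
      case (step y z)
      then have "(y, z) \<in> ?R \<or> y = a \<and> z = b \<and> b \<in> X \<or> y = b \<and> z = a \<and> b \<in> X"
        using assms(2) by (auto simp: within_def both_ways_def)
      then have "(y, z) \<in> ?R\<^sup>*" using ab by blast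
      then show ?case using step.IH by simp
    qed simp
  qed
  fix x assume "x \<in> X \<union> Y"
  then show "(a, x) \<in> ?R\<^sup>*"
  proof
    assume "x \<in> Y"
    then have "(a, x) \<in> (within E' (Y \<union> {a}))\<^sup>*" using aY by (simp add: conn_def)
    then show ?thesis by (rule within_rtrancl_mono) (use \<open>a \<in> X\<close> in auto)
  qed (rule X)
qed

text \<open>The branch set containing \<open>a\<close>, if any, absorbs \<open>Y\<close>.\<close>

lemma K4_replace_edge:
  assumes "sym E'" "E \<subseteq> E'" "K4 (E \<union> both_ways a b)"
    and Y: "conn E' Y" "touch E' Y {a}" "touch E' Y {b}"
    and disj: "Y \<inter> Field E = {}" "a \<notin> Y" "b \<notin> Y"
  shows "K4 E'"
proof -
  let ?E = "E \<union> both_ways a b"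
  obtain B where B: "K4_model ?E B" using assms(3) by (auto simp: K4_def)
  have BY: "B i \<inter> Y = {}" if "i < 4" for i
    using K4_model_Field[OF B that] disj by (auto simp: both_ways_def Field_def)
  define C where "C i = (if a \<in> B i then B i \<union> Y else B i)" for i
  have "K4_model E' C"
    unfolding K4_model_def
  proof (intro conjI allI impI)
    fix i :: nat assume "i < 4"
    then have conn: "conn ?E (B i)" using B by (simp add: K4_model_def)
    show "conn E' (C i)"
    proof (cases "a \<in> B i")
      case True
      then show ?thesis
        using conn_replace_edge[OF assms(1,2) conn Y] by (simp add: C_def)
    next
      case False
      \<comment> \<open>Without \<open>a\<close>, the branch set cannot use the edge
        \<open>ab\<close> internally.\<close>
      then have "within ?E (B i) \<subseteq> within E' (B i)"
        using assms(2) by (auto simp: within_def both_ways_def)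
      from rtrancl_mono[OF this] show ?thesis
        using False conn unfolding conn_def C_def by auto
    qed
  next
    fix i j :: nat assume ij: "i < 4" "j < 4" "i \<noteq> j"
    then have D: "B i \<inter> B j = {}" and T: "touch ?E (B i) (B j)"
      using B by (auto simp: K4_model_def)
    show "C i \<inter> C j = {}"
      using D BY ij by (auto simp: C_def)
    obtain x y where xy: "x \<in> B i" "y \<in> B j" "(x, y) \<in> ?E" using T by (auto simp: touch_def)
    consider "(x, y) \<in> E" | "x = a" "y = b" | "x = b" "y = a"
      using xy by (auto simp: both_ways_def)
    then show "touch E' (C i) (C j)"
    proof cases
      case 1
      then have "touch E' (B i) (B j)" using xy assms(2) by (auto simp: touch_def)
      then show ?thesis by (rule touch_mono) (auto simp: C_def)
    next
      case 2
      show ?thesis using Y(3) by (rule touch_mono) (use 2 xy in \<open>auto simp: C_def\<close>)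
    next
      case 3
      show ?thesis using touch_sym[OF assms(1) Y(3)]
        by (rule touch_mono) (use 3 xy in \<open>auto simp: C_def\<close>)
    qed
  qed
  then show ?thesis by (auto simp: K4_def)
qed

subsection \<open>Two internally disjoint paths\<close>

text \<open>The invariant of the augmentation: \<open>x\<close> is reached from \<open>a\<close> through \<open>P\<close> and through \<open>Q\<close>,
  which share only \<open>a\<close>.\<close>

definition two_ways :: "('v \<times> 'v) set \<Rightarrow> 'v \<Rightarrow> 'v \<Rightarrow> 'v set \<Rightarrow> 'v set \<Rightarrow> bool" where
  "two_ways E a x P Q \<longleftrightarrow> conn E P \<and> conn E Q \<and> P \<inter> Q = {a} \<and> x \<notin> P \<and> x \<notin> Q \<and>
     touch E {x} P \<and> touch E {x} Q"

lemma two_ways_sym: "two_ways E a x P Q \<Longrightarrow> two_ways E a x Q P"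
  by (auto simp: two_ways_def)

text \<open>The first way, in the form \<open>P1\<close>, is cut off just before \<open>y\<close>,
  and the second one is prolonged by \<open>x\<close>. In the applications \<open>P1\<close> is the
  old way, possibly enlarged so as to contain \<open>y\<close>.\<close>

lemma two_ways_advance:
  assumes "sym E" "two_ways E a x P Q" "(x, y) \<in> E" "y \<noteq> x" "y \<noteq> a"
    and P1: "conn E P1" "P1 \<inter> Q = {a}" "y \<in> P1" "x \<notin> P1"
  shows "\<exists>P Q. two_ways E a y P Q"
proof -
  let ?P = "component E (P1 - {y}) a"
  have a: "a \<in> P1" "a \<in> Q" using P1(2) by auto
  have sub: "?P \<subseteq> P1 - {y}" using a assms(5) by (intro component_subset) blast
  have "(a, y) \<in> (within E P1)\<^sup>*" using P1(1) a(1) P1(3) by (rule conn_pathD)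
  moreover have "y \<notin> ?P" using sub by blast
  ultimately obtain z z' where z: "(z, z') \<in> E" "z \<in> ?P" "z' \<notin> ?P" "z \<in> P1" "z' \<in> P1"
    using exit_edge[OF _ component_self] by metis
  then have "z' = y" using component_step[OF z(2,1)] sub by blast
  then have "touch E {y} ?P" using z assms(1) by (auto simp: touch_def dest: symD)
  moreover have "conn E (Q \<union> {x})"
    using assms(1,2) touch_sym by (intro conn_Un conn_singleton) (auto simp: two_ways_def)
  moreover have "touch E {y} (Q \<union> {x})"
    using assms(1,3) by (auto simp: touch_def dest: symD)
  moreover have "?P \<inter> (Q \<union> {x}) = {a}" using sub P1 a component_self[of a E] by blast
  moreover have "y \<notin> Q \<union> {x}" using P1 assms(4,5) by blast
  ultimately have "two_ways E a y ?P (Q \<union> {x})"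
    using conn_component[OF assms(1)] sub by (auto simp: two_ways_def)
  then show ?thesis by blast
qed

text \<open>If \<open>y\<close> is on neither way, the component of \<open>y\<close> outside both
  ways and \<open>x\<close> touches one of them, since \<open>y\<close> reaches \<open>a\<close>
  without \<open>x\<close>. That way absorbs the component and then contains
  \<open>y\<close>.\<close>

lemma two_ways_step:
  assumes "sym E" "two_ways E a x P Q" "(x, y) \<in> E" "y \<noteq> x" "y \<noteq> a"
    and avoid: "(y, a) \<in> (within E (- {x}))\<^sup>*"
  shows "\<exists>P Q. two_ways E a y P Q"
proof -
  have tw: "conn E P" "conn E Q" "P \<inter> Q = {a}" "x \<notin> P" "x \<notin> Q"
    using assms(2) by (auto simp: two_ways_def)
  consider "y \<in> P" | "y \<in> Q" | "y \<notin> P \<union> Q" by blast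
  then show ?thesis
  proof cases
    case 1
    then show ?thesis using two_ways_advance[OF assms(1-5)] tw by blast
  next
    case 2
    then show ?thesis
      using two_ways_advance[OF assms(1) two_ways_sym[OF assms(2)] assms(3-5)] tw by blast
  next
    case 3
    let ?X = "- (P \<union> Q \<union> {x})"
    let ?R = "component E ?X y"
    have sub: "?R \<subseteq> ?X" using 3 assms(4) by (intro component_subset) blast
    have "a \<notin> ?R" using sub tw by blast
    then obtain z z' where z: "(z, z') \<in> E" "z \<in> ?R" "z' \<notin> ?R" "z' \<noteq> x"
      using exit_edge[OF avoid component_self] by blast
    then have "z' \<in> P \<union> Q" using component_step[OF z(2,1)] sub by blast
    have R: "conn E ?R" "y \<in> ?R" using conn_component[OF assms(1)] component_self by auto
    from \<open>z' \<in> P \<union> Q\<close> show ?thesis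
    proof
      assume "z' \<in> P"
      then have "touch E ?R P" using z by (auto simp: touch_def)
      then have "conn E (?R \<union> P)" using conn_Un[OF assms(1)] R tw by blast
      moreover have "(?R \<union> P) \<inter> Q = {a}" "x \<notin> ?R \<union> P" using sub tw by blast+
      ultimately show ?thesis using two_ways_advance[OF assms(1-5)] R by blast
    next
      assume "z' \<in> Q"
      then have "touch E ?R Q" using z by (auto simp: touch_def)
      then have "conn E (?R \<union> Q)" using conn_Un[OF assms(1)] R tw by blast
      moreover have "(?R \<union> Q) \<inter> P = {a}" "x \<notin> ?R \<union> Q" using sub tw by blast+
      ultimately show ?thesis
        using two_ways_advance[OF assms(1) two_ways_sym[OF assms(2)] assms(3-5)] R by blast
    qed
  qed
qed

text \<open>A walk meeting \<open>x\<close> has a final piece that starts at \<open>x\<close> and is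
  no longer than the walk. For a shortest walk this excludes a return to \<open>x\<close>.\<close>

lemma relpow_avoid:
  assumes "(y, b) \<in> E ^^ n"
  shows "(y, b) \<in> (within E (- {x}))\<^sup>* \<or> (\<exists>m\<le>n. (x, b) \<in> E ^^ m)"
  using assms
proof (induction n arbitrary: y)
  case (Suc n)
  obtain z where z: "(y, z) \<in> E" "(z, b) \<in> E ^^ n"
    using Suc.prems relpow_Suc_D2 by metis
  show ?case
  proof (cases "y = x \<or> (\<exists>m\<le>n. (x, b) \<in> E ^^ m)")
    case True
    then show ?thesis using Suc.prems le_Suc_eq by blast
  next
    case False
    then have zb: "(z, b) \<in> (within E (- {x}))\<^sup>*" using Suc.IH[OF z(2)] by blast
    have "z \<noteq> x" using False z(2) by blast
    then have "(y, z) \<in> within E (- {x})" using z(1) False by (auto simp: within_def)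
    then show ?thesis using zb by (meson converse_rtrancl_into_rtrancl)
  qed
qed simp

text \<open>Menger's theorem for two paths: advance \<open>two_ways\<close> along a shortest path to \<open>b\<close>.\<close>

lemma inseparable_two_ways:
  assumes "sym E" and irrefl: "\<And>x. (x, x) \<notin> E" and "inseparable E a b"
  shows "\<exists>P Q. two_ways E a b P Q"
proof -
  \<comment> \<open>\<open>n\<close> is the length of a walk to \<open>b\<close> from some vertex
    already reached in two ways. The least such \<open>n\<close> turns out to be 0, so that this
    vertex is \<open>b\<close>.\<close>
  define reach where "reach n \<longleftrightarrow> (\<exists>x P Q. two_ways E a x P Q \<and> (x, b) \<in> E ^^ n)" for n
  \<comment> \<open>Degenerate start: for a neighbour of \<open>a\<close>, both ways consist of
    \<open>a\<close> alone.\<close>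
  have start: "two_ways E a x {a} {a}" if "(a, x) \<in> E" for x
    using that irrefl assms(1)
    by (auto simp: two_ways_def conn_singleton touch_def dest: symD)
  have "a \<noteq> b" "(a, b) \<in> E\<^sup>*" using assms(3) by (auto simp: inseparable_def)
  then obtain x where "(a, x) \<in> E" "(x, b) \<in> E\<^sup>*" by (meson converse_rtranclE)
  then have "\<exists>n. reach n" using start rtrancl_imp_relpow unfolding reach_def by blast
  then obtain n where n: "reach n" "\<And>m. m < n \<Longrightarrow> \<not> reach m"
    using exists_least_iff[of reach] by blast
  then obtain x P Q where x: "two_ways E a x P Q" "(x, b) \<in> E ^^ n" by (auto simp: reach_def)
  show ?thesis
  proof (cases n)
    case 0
    then show ?thesis using x by auto
  next
    case (Suc k)
    then obtain y where y: "(x, y) \<in> E" "(y, b) \<in> E ^^ k"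
      using x(2) relpow_Suc_D2 by metis
    have least: "\<not> (\<exists>P Q. two_ways E a z P Q)" if "(z, b) \<in> E ^^ m" "m < n" for z m
      using n(2)[OF that(2)] that(1) by (auto simp: reach_def)
    have "x \<noteq> b" using least[of x 0] x(1) Suc by auto
    have "x \<noteq> a" using x(1) by (auto simp: two_ways_def)
    have "y \<noteq> x" using y irrefl by blast
    \<comment> \<open>A walk returning to \<open>a\<close> could be replaced by its part after
      \<open>a\<close>, which is shorter and starts at a neighbour of \<open>a\<close>.\<close>
    have "y \<noteq> a"
    proof
      assume "y = a"
      then obtain l where l: "k = Suc l" using y(2) \<open>a \<noteq> b\<close> by (cases k) auto
      then obtain z where "(a, z) \<in> E" "(z, b) \<in> E ^^ l"
        using y(2) \<open>y = a\<close> relpow_Suc_D2 by metis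
      then show False using least[of z l] start l Suc by auto
    qed
    \<comment> \<open>By minimality no walk of length at most \<open>k\<close> leads from
      \<open>x\<close> to \<open>b\<close>.\<close>
    have "(y, b) \<in> (within E (- {x}))\<^sup>*"
      using relpow_avoid[OF y(2), of x] least x(1) Suc by (meson le_imp_less_Suc)
    moreover have "(a, b) \<in> (within E (- {x}))\<^sup>*"
      using assms(3) \<open>x \<noteq> a\<close> \<open>x \<noteq> b\<close> by (auto simp: inseparable_def)
    ultimately have "(y, a) \<in> (within E (- {x}))\<^sup>*"
      using sym_rtranclD[OF sym_within[OF assms(1)]] by (meson rtrancl_trans)
    then have "\<exists>P Q. two_ways E a y P Q"
      using two_ways_step[OF assms(1) x(1) y(1) \<open>y \<noteq> x\<close> \<open>y \<noteq> a\<close>] by blast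
    then show ?thesis using least[OF y(2)] Suc by auto
  qed
qed

text \<open>\<open>P\<close> is entered from \<open>b\<close> at some \<open>p\<close>, which
  differs from \<open>a\<close> because \<open>a\<close> and \<open>b\<close> are not adjacent. The
  component of \<open>p\<close> in \<open>P\<close> without \<open>a\<close> serves as the nonempty
  interior of a path between \<open>a\<close> and \<open>b\<close>.\<close>

lemma inner_part:
  assumes "sym E" "conn E P" "a \<in> P" "b \<notin> P" "touch E {b} P" "(a, b) \<notin> E"
  shows "\<exists>X. conn E X \<and> X \<subseteq> P - {a} \<and> touch E X {a} \<and> touch E X {b}"
proof -
  obtain p where p: "p \<in> P" "(b, p) \<in> E" using assms(5) by (auto simp: touch_def)
  then have "p \<noteq> a" using assms(1,6) by (auto dest: symD)
  let ?X = "component E (P - {a}) p"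
  have sub: "?X \<subseteq> P - {a}" using p \<open>p \<noteq> a\<close> by (intro component_subset) blast
  obtain z z' where z: "(z, z') \<in> E" "z \<in> ?X" "z' \<notin> ?X" "z' \<in> P"
    using exit_edge[OF conn_pathD[OF assms(2) p(1) assms(3)] component_self] sub by blast
  then have "z' = a" using component_step[OF z(2,1)] sub by blast
  then have "touch E ?X {a}" using z by (auto simp: touch_def)
  moreover have "touch E ?X {b}"
    using p assms(1) component_self[of p E] by (auto simp: touch_def dest: symD)
  ultimately show ?thesis using sub conn_component[OF assms(1)] by blast
qed

lemma inseparable_disjoint_links:
  assumes "sym E" "\<And>x. (x, x) \<notin> E" "inseparable E a b" "(a, b) \<notin> E"
  obtains X Y where "conn E X" "conn E Y" "X \<inter> Y = {}" "X \<subseteq> - {a, b}" "Y \<subseteq> - {a, b}"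
    "touch E X {a}" "touch E X {b}" "touch E Y {a}" "touch E Y {b}"
proof -
  obtain P Q where PQ: "conn E P" "conn E Q" "P \<inter> Q = {a}" "b \<notin> P" "b \<notin> Q"
      "touch E {b} P" "touch E {b} Q"
    using inseparable_two_ways[OF assms(1-3)] by (auto simp: two_ways_def)
  then have "a \<in> P" "a \<in> Q" by auto
  obtain X where X: "conn E X" "X \<subseteq> P - {a}" "touch E X {a}" "touch E X {b}"
    using inner_part[OF assms(1) PQ(1) \<open>a \<in> P\<close> PQ(4,6) assms(4)] by blast
  obtain Y where Y: "conn E Y" "Y \<subseteq> Q - {a}" "touch E Y {a}" "touch E Y {b}"
    using inner_part[OF assms(1) PQ(2) \<open>a \<in> Q\<close> PQ(5,7) assms(4)] by blast
  show thesis by (rule that[OF X(1) Y(1) _ _ _ X(3,4) Y(3,4)]) (use X Y PQ in blast)+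
qed

section \<open>\<open>K4\<close> minors across a two-vertex separator\<close>

lemma K4_of_linked_sides:
  assumes "sym E" "a \<noteq> b" "(a, b) \<in> E"
    and "conn E X" "conn E Y" "X \<inter> Y = {}" "X \<subseteq> - {a, b}" "Y \<subseteq> - {a, b}"
    and "touch E X {a}" "touch E X {b}" "touch E Y {a}" "touch E Y {b}"
    and "touch E X Y"
  shows "K4 E"
proof (rule K4I[of E "{a}" "{b}" X Y])
  show "touch E {a} {b}" using assms(3) by (simp add: touch_def)
  show "touch E {a} X" "touch E {b} X" "touch E {a} Y" "touch E {b} Y"
    using assms touch_sym by metis+
qed (use assms conn_singleton in auto)

text \<open>If the component met \<open>Y\<close>, its part reachable without entering
  \<open>Y\<close> would contain \<open>X\<close>, be disjoint from \<open>Y\<close> and still touch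
  \<open>Y\<close>. With the edge \<open>ab\<close> this would give four branch sets.\<close>

lemma component_inter_empty:
  assumes "sym E" "a \<noteq> b" "\<not> K4 (E \<union> both_ways a b)"
    and "conn E X" "conn E Y" "X \<inter> Y = {}" "X \<subseteq> - {a, b}" "Y \<subseteq> - {a, b}"
    and "touch E X {a}" "touch E X {b}" "touch E Y {a}" "touch E Y {b}" and "x \<in> X"
  shows "component E (- {a, b}) x \<inter> Y = {}"
proof (rule ccontr)
  assume "component E (- {a, b}) x \<inter> Y \<noteq> {}"
  then obtain y where y: "y \<in> Y" "(x, y) \<in> (within E (- {a, b}))\<^sup>*"
    by (auto simp: component_def)
  let ?Z = "- {a, b} - Y"
  let ?K = "component E ?Z x"
  let ?E = "E \<union> both_ways a b"
  have x: "x \<in> ?Z" using assms by blast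
  then have sub: "?K \<subseteq> ?Z" by (rule component_subset)
  have XK: "X \<subseteq> ?K" using assms by (intro conn_subset_component) auto
  obtain z z' where z: "(z, z') \<in> E" "z \<in> ?K" "z' \<notin> ?K" "z' \<in> - {a, b}"
    using exit_edge[OF y(2) component_self] sub y(1) by blast
  then have "z' \<in> Y" using component_step[OF z(2,1)] sub by blast
  then have "touch E ?K Y" using z by (auto simp: touch_def)
  have sub_E: "E \<subseteq> ?E" by blast
  have "sym ?E" using assms(1) by (intro sym_Un sym_both_ways)
  then have "K4 ?E"
  proof (rule K4_of_linked_sides[of ?E a b ?K Y])
    show "touch ?E ?K {a}" "touch ?E ?K {b}" "touch ?E Y {a}" "touch ?E Y {b}"
      using touch_mono[OF _ sub_E] XK assms by auto
    show "conn ?E ?K" "conn ?E Y"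
      using conn_mono[OF _ sub_E] conn_component[OF assms(1)] assms(5) by blast+
    show "touch ?E ?K Y" using touch_mono[OF \<open>touch E ?K Y\<close> sub_E] by blast
  qed (use assms sub in \<open>auto simp: both_ways_def\<close>)
  then show False using assms by blast
qed

text \<open>The fourth branch set is the component \<open>L\<close> of \<open>q\<close>, joined to
  \<open>K\<close> by the edge \<open>pq\<close>. It touches both \<open>a\<close> and
  \<open>b\<close>: a walk from \<open>q\<close> to \<open>p\<close> that avoids one of them can
  leave \<open>L\<close> only through the other.\<close>

lemma crossing_pair_K4:
  assumes "sym E" "a \<noteq> b"
    and K: "K = component E (- {a, b}) x" "x \<notin> {a, b}" "touch E K {a}" "touch E K {b}"
    and pq: "p \<in> K" "q \<notin> K" "q \<notin> {a, b}" "inseparable E p q"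
  shows "K4 (E \<union> both_ways a b \<union> both_ways p q)"
proof -
  let ?E = "E \<union> both_ways a b \<union> both_ways p q"
  have subK: "K \<subseteq> - {a, b}" unfolding K(1) using K(2) by (intro component_subset) blast
  define L where "L = component E (- {a, b}) q"
  have subL: "L \<subseteq> - {a, b}" unfolding L_def using pq by (intro component_subset) blast
  have "K \<inter> L = {}"
  proof (rule ccontr)
    assume "K \<inter> L \<noteq> {}"
    then obtain z where "(x, z) \<in> (within E (- {a, b}))\<^sup>*" "(q, z) \<in> (within E (- {a, b}))\<^sup>*"
      by (auto simp: K(1) L_def component_def)
    then have "(x, q) \<in> (within E (- {a, b}))\<^sup>*"
      using sym_rtranclD[OF sym_within[OF assms(1)]] by (meson rtrancl_trans)
    then show False using pq(2) by (simp add: K(1) component_def)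
  qed
  have avoid: "(q, p) \<in> (within E (- {c}))\<^sup>*" if "c \<in> {a, b}" for c
  proof -
    have "c \<noteq> p" "c \<noteq> q" using that pq subK by auto
    then show ?thesis using pq(4) sym_rtranclD[OF sym_within[OF assms(1)]]
      by (auto simp: inseparable_def)
  qed
  have touchL: "touch E L {d}" if "{c, d} = {a, b}" for c d
  proof -
    have "p \<notin> L" "q \<in> L" using pq \<open>K \<inter> L = {}\<close> component_self by (auto simp: L_def)
    moreover have "c \<in> {a, b}" using that by blast
    ultimately obtain z z' where z: "(z, z') \<in> E" "z \<in> L" "z' \<notin> L" "z' \<noteq> c"
      using exit_edge[OF avoid] by (metis ComplD singletonI)
    then have "z' \<in> {a, b}"
      using component_step[of z E "- {a, b}" q z'] subL unfolding L_def by blast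
    then have "z' = d" using z(4) that by blast
    then show ?thesis using z by (auto simp: touch_def)
  qed
  have sub_E: "E \<subseteq> ?E" by blast
  have "sym ?E" using assms(1) by (intro sym_Un sym_both_ways)
  then show ?thesis
  proof (rule K4_of_linked_sides[of ?E a b K L])
    show "touch ?E K {a}" "touch ?E K {b}" "touch ?E L {a}" "touch ?E L {b}"
      using touch_mono[OF _ sub_E] K touchL[of a b] touchL[of b a] by auto
    show "conn ?E K" "conn ?E L"
      using conn_mono[OF _ sub_E] conn_component[OF assms(1)] unfolding K(1) L_def by blast+
    show "touch ?E K L" using pq component_self[of q E]
      by (auto simp: touch_def both_ways_def L_def)
  qed (use assms(2) \<open>K \<inter> L = {}\<close> subK subL in \<open>auto simp: both_ways_def\<close>)
qed

text \<open>An excursion of a walk into \<open>B\<close> begins and ends at \<open>a\<close> or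
  \<open>b\<close>, so the edge \<open>ab\<close> shortcuts it. If the avoided vertex is one of
  these two, the excursion returns to where it began.\<close>

lemma inseparable_in_side:
  assumes sep: "E \<subseteq> A \<times> A \<union> B \<times> B" "A \<inter> B = {a, b}"
    and pq: "inseparable E p q" "p \<in> A" "q \<in> A"
  shows "inseparable (within E A \<union> both_ways a b) p q"
proof -
  let ?E = "E \<union> both_ways a b" and ?D = "within E A \<union> both_ways a b"
  have ab: "a \<in> A" "b \<in> A" "a \<in> B" "b \<in> B" using sep(2) by auto
  have sep': "?E \<subseteq> A \<times> A \<union> B \<times> B" "(a, b) \<in> ?E" "(b, a) \<in> ?E"
    using sep ab by (auto simp: both_ways_def)
  have path: "(p, q) \<in> (within ?D X)\<^sup>*" if "(p, q) \<in> (within E X)\<^sup>*" "p \<in> X" for X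
  proof -
    have "(p, q) \<in> (within ?E X)\<^sup>*" using that(1) by (rule within_rtrancl_mono) auto
    then have "(p, q) \<in> (within ?E (X \<inter> A))\<^sup>*"
      using path_in_side[OF sep'(1) sep(2) sep'(2,3)] that(2) pq by blast
    moreover have "within ?E (X \<inter> A) \<subseteq> within ?D X" by (auto simp: within_def)
    ultimately show ?thesis using rtrancl_mono by blast
  qed
  have univ: "within R UNIV = R" for R by (simp add: within_def)
  show ?thesis
    using pq path[of UNIV] path[of "- {c}" for c]
    unfolding inseparable_def univ by auto
qed

subsection \<open>Virtual edges\<close>

text \<open>\<open>M\<close> consists of the virtual edges.\<close>

lemma K4_free_virtual_edges:
  assumes "finite E" "sym E" "\<And>x. (x, x) \<notin> E" "sym M" "\<not> K4 E"
    and "\<And>p q. (p, q) \<in> M \<Longrightarrow> inseparable E p q"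
    and "\<And>p q r s. (p, q) \<in> M \<Longrightarrow> (r, s) \<in> M \<Longrightarrow> \<not> K4 (E \<union> both_ways p q \<union> both_ways r s)"
  shows "\<not> K4 (E \<union> M)"
  using assms
proof (induction "card (Field E)" arbitrary: E M rule: less_induct)
  case less
  note sym_E = less.prems(2) and compat = less.prems(7)
  show ?case
  proof (cases "M \<subseteq> E")
    case True
    then show ?thesis using less.prems(5) by (simp add: sup.absorb1)
  next
    case False
    then obtain a b where ab: "(a, b) \<in> M" "(a, b) \<notin> E" by auto
    then have "(b, a) \<in> M" using less.prems(4) by (auto dest: symD)
    have insep: "inseparable E a b" using less.prems(6) ab by blast
    then have "a \<noteq> b" by (simp add: inseparable_def)
    obtain X Y where XY: "conn E X" "conn E Y" "X \<inter> Y = {}" "X \<subseteq> - {a, b}" "Y \<subseteq> - {a, b}"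
        "touch E X {a}" "touch E X {b}" "touch E Y {a}" "touch E Y {b}"
      using inseparable_disjoint_links[OF sym_E less.prems(3) insep ab(2)] by blast
    obtain x where "x \<in> X" using XY(1) by (auto simp: conn_def)
    define K where "K = component E (- {a, b}) x"
    \<comment> \<open>The hypothesis on pairs, applied to the same edge twice, covers a single
      virtual edge.\<close>
    have "\<not> K4 (E \<union> both_ways a b)" using compat[OF ab(1) ab(1)] by (simp add: Un_assoc)
    then have KY: "K \<inter> Y = {}"
      unfolding K_def using component_inter_empty[OF sym_E \<open>a \<noteq> b\<close> _ XY \<open>x \<in> X\<close>] by blast
    have "X \<subseteq> K" unfolding K_def using XY \<open>x \<in> X\<close> by (intro conn_subset_component)
    then have touchK: "touch E K {a}" "touch E K {b}" using XY touch_mono[OF _ order_refl] by blast+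
    have connK: "conn E K" unfolding K_def by (rule conn_component[OF sym_E])
    have subK: "K \<subseteq> - {a, b}"
      unfolding K_def using XY \<open>x \<in> X\<close> by (intro component_subset) blast
    \<comment> \<open>\<open>B\<close> receives all remaining vertices, so that only edges with an
      end in \<open>K\<close> have to be checked.\<close>
    define A where "A = K \<union> {a, b}"
    define B where "B = - K"
    have AB: "A \<inter> B = {a, b}" "B \<inter> A = {a, b}" using subK by (auto simp: A_def B_def)
    have E_side: "q \<in> A" if "(p, q) \<in> E" "p \<in> K" for p q
      using that subK component_step[of p E "- {a, b}" x q] unfolding A_def K_def by blast
    \<comment> \<open>A virtual edge from \<open>K\<close> to a vertex beyond \<open>a\<close> and
      \<open>b\<close> would form a \<open>K4\<close> minor together with \<open>ab\<close>.\<close>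
    have M_side: "q \<in> A" if "(p, q) \<in> M" "p \<in> K" for p q
      using crossing_pair_K4[OF sym_E \<open>a \<noteq> b\<close> K_def _ touchK that(2), of q]
        compat[OF ab(1) that(1)] less.prems(6)[OF that(1)] XY \<open>x \<in> X\<close>
      unfolding A_def by blast
    have side: "q \<in> A" if "(p, q) \<in> E \<union> M" "p \<in> K" for p q
      using that E_side M_side by blast
    have sym_EM: "sym (E \<union> M)" using sym_E less.prems(4) by (rule sym_Un)
    have sep: "E \<union> M \<subseteq> A \<times> A \<union> B \<times> B"
    proof (rule subrelI)
      fix p q assume "(p, q) \<in> E \<union> M"
      moreover then have "(q, p) \<in> E \<union> M" using sym_EM by (auto dest: symD)
      ultimately show "(p, q) \<in> A \<times> A \<union> B \<times> B"
        using side[of p q] side[of q p] unfolding A_def B_def by blast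
    qed
    \<comment> \<open>This treats both sides at once. \<open>C\<close> is the side kept, and
      \<open>Z\<close> is a link between \<open>a\<close> and \<open>b\<close> on the other side:
      \<open>Y\<close> when \<open>A\<close> is kept, \<open>K\<close> when \<open>B\<close> is
      kept.\<close>
    have smaller: "\<not> K4 (within (E \<union> M) C)"
      if C: "E \<union> M \<subseteq> C \<times> C \<union> D \<times> D" "C \<inter> D = {a, b}"
        and Z: "conn E Z" "Z \<inter> C = {}" "touch E Z {a}" "touch E Z {b}" for C D Z
    proof -
      let ?E = "within E C \<union> both_ways a b" and ?M = "within M C"
      have abC: "a \<in> C" "b \<in> C" using C(2) by auto
      \<comment> \<open>The edge \<open>ab\<close> added to the side is simulated in
        \<open>E\<close> by the link \<open>Z\<close>. \<open>N\<close> will be empty or consist of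
        two virtual edges.\<close>
      have restore: "\<not> K4 (?E \<union> N)" if "\<not> K4 (E \<union> N)" "sym N" "N \<subseteq> C \<times> C" for N
      proof
        assume "K4 (?E \<union> N)"
        then have "K4 ((within E C \<union> N) \<union> both_ways a b)" by (simp add: Un_ac)
        moreover have "sym (E \<union> N)" using sym_E that(2) by (rule sym_Un)
        moreover have "Z \<inter> Field (within E C \<union> N) = {}"
          using Z(2) that(3) by (auto simp: within_def Field_def)
        moreover have "conn (E \<union> N) Z" using Z(1) by (rule conn_mono) blast
        moreover have "touch (E \<union> N) Z {a}" "touch (E \<union> N) Z {b}"
          by (rule touch_mono[OF Z(3)] touch_mono[OF Z(4)]; blast)+
        moreover have "a \<notin> Z" "b \<notin> Z" using abC Z(2) by auto
        moreover have "within E C \<union> N \<subseteq> E \<union> N" by (auto simp: within_def)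
        ultimately have "K4 (E \<union> N)" 
          using K4_replace_edge[of "E \<union> N" "within E C \<union> N" a b Z] by simp
        then show False using that(1) by blast
      qed
      have "\<not> K4 (?E \<union> ?M)"
      proof (rule less.hyps)
        \<comment> \<open>The side loses the vertex \<open>z\<close>, while the ends of the added
          edge were already present.\<close>
        obtain z where z: "z \<in> Z" "(z, a) \<in> E" using Z(3) by (auto simp: touch_def)
        then have "z \<in> Field E" "a \<in> Field E" by (auto simp: Field_def)
        moreover have "b \<in> Field E" using Z(4) by (auto simp: touch_def Field_def)
        moreover have "Field ?E \<subseteq> (Field E \<inter> C) \<union> {a, b}"
          by (auto simp: within_def both_ways_def Field_def)
        moreover have "z \<notin> C" using z(1) Z(2) by blast
        ultimately have "Field ?E \<subset> Field E" using abC by blast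
        then show "card (Field ?E) < card (Field E)"
          using less.prems(1) by (simp add: psubset_card_mono finite_Field)
        show "finite ?E" using less.prems(1) by (simp add: within_def both_ways_def)
        show "sym ?E" using sym_E by (intro sym_Un sym_within sym_both_ways)
        show "sym ?M" using less.prems(4) by (rule sym_within)
        show "(u, u) \<notin> ?E" for u
          using less.prems(3) \<open>a \<noteq> b\<close> by (auto simp: within_def both_ways_def)
        show "\<not> K4 ?E" using restore[of "{}"] less.prems(5) by (simp add: sym_def)
        show "inseparable ?E p q" if "(p, q) \<in> ?M" for p q
          using inseparable_in_side[of E C D a b p q] C less.prems(6) that
          by (auto simp: within_def)
        show "\<not> K4 (?E \<union> both_ways p q \<union> both_ways r s)" if "(p, q) \<in> ?M" "(r, s) \<in> ?M"
          for p q r s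
        proof -
          have "\<not> K4 (E \<union> (both_ways p q \<union> both_ways r s))"
            using compat[of p q r s] that by (simp add: within_def Un_assoc)
          then have "\<not> K4 (?E \<union> (both_ways p q \<union> both_ways r s))"
          proof (rule restore)
            show "sym (both_ways p q \<union> both_ways r s)" by (intro sym_Un sym_both_ways)
            show "both_ways p q \<union> both_ways r s \<subseteq> C \<times> C"
              using that by (auto simp: within_def both_ways_def)
          qed
          then show ?thesis by (simp add: Un_assoc)
        qed
      qed
      moreover have "within (E \<union> M) C \<subseteq> ?E \<union> ?M" by (auto simp: within_def)
      ultimately show ?thesis using K4_mono by blast
    qed
    have "\<not> K4 (within (E \<union> M) A)"
      by (rule smaller[OF sep AB(1) XY(2) _ XY(8,9)]) (use KY XY in \<open>auto simp: A_def\<close>)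
    moreover have "\<not> K4 (within (E \<union> M) B)"
    proof (rule smaller[OF _ AB(2) connK _ touchK])
      show "E \<union> M \<subseteq> B \<times> B \<union> A \<times> A" using sep by blast
      show "K \<inter> B = {}" by (simp add: B_def)
    qed
    ultimately show ?thesis
      using K4_two_sum[OF sep AB(1)] ab(1) \<open>(b, a) \<in> M\<close> by blast
  qed
qed

text \<open>Picking one vertex from each branch set is injective. This disposes of the triangle
  split off in \<open>K4_suppress\<close>.\<close>

lemma K4_needs_four_vertices:
  assumes "E \<subseteq> {u, v, w} \<times> {u, v, w}"
  shows "\<not> K4 E"
proof
  assume "K4 E"
  then obtain B where B: "K4_model E B" by (auto simp: K4_def)
  have "\<forall>i<4. \<exists>x. x \<in> B i" using B by (auto simp: K4_model_def conn_def)
  then obtain f where f: "\<And>i. i < 4 \<Longrightarrow> f i \<in> B i" by metis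
  have "inj_on f {..<4}"
  proof (rule inj_onI, rule ccontr)
    fix i j assume "i \<in> {..<4::nat}" "j \<in> {..<4}" "f i = f j" "i \<noteq> j"
    then show False using B f[of i] f[of j] by (auto simp: K4_model_def)
  qed
  moreover have "f ` {..<4} \<subseteq> {u, v, w}"
  proof (rule image_subsetI)
    fix i assume "i \<in> {..<4::nat}"
    then have "f i \<in> Field E" using f K4_model_Field[OF B] by blast
    then show "f i \<in> {u, v, w}" using assms by (auto simp: Field_def)
  qed
  ultimately have "card {..<4::nat} \<le> card {u, v, w}" by (intro card_inj_on_le) auto
  moreover have "card {u, v, w} \<le> 3" by (simp add: card_insert_if)
  ultimately show False by simp
qed

subsection \<open>From multigraphs to adjacency relations\<close>

definition adj_rel :: "('v, 'e) mgraph \<Rightarrow> ('v \<times> 'v) set" where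
  "adj_rel G = {(u, v). adj G u v}"

lemma sym_adj_rel: "sym (adj_rel G)"
  by (auto simp: adj_rel_def adj_def sym_def insert_commute)

lemma adj_rtranclp: "(adj G)\<^sup>*\<^sup>* u v \<longleftrightarrow> (u, v) \<in> (adj_rel G)\<^sup>*"
  by (simp add: rtranclp_rtrancl_eq adj_rel_def)

lemma adj_induced: "adj (induced G X) u v \<longleftrightarrow> adj G u v \<and> u \<in> X \<and> v \<in> X"
  by (auto simp: adj_def induced_def)

lemma adj_rel_induced: "adj_rel (induced G X) = within (adj_rel G) X"
  by (auto simp: adj_rel_def adj_induced within_def)

lemma adj_verts:
  "multigraph G \<Longrightarrow> adj G u v \<Longrightarrow> u \<in> verts G \<and> v \<in> verts G \<and> u \<noteq> v"
  by (auto simp: multigraph_def adj_def)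

lemma connected_induced:
  assumes "X \<subseteq> verts G"
  shows "connected_graph (induced G X) \<longleftrightarrow> conn (adj_rel G) X"
proof -
  have "verts (induced G X) = X" using assms by (auto simp: induced_def)
  then show ?thesis
    by (simp add: connected_graph_def conn_def adj_rtranclp adj_rel_induced)
qed

text \<open>One direction forgets the names of edges. For the other, an edge of \<open>G\<close> is
  picked for every edge of \<open>complete_graph 4\<close>, and disjointness of the branch sets
  makes the choice injective.\<close>

lemma has_K4_minor_iff:
  assumes "multigraph G"
  shows "has_K4_minor G \<longleftrightarrow> K4 (adj_rel G)"
proof
  assume "has_K4_minor G"
  then obtain \<phi> :: "nat \<Rightarrow> 'a set" and \<psi> :: "nat set \<Rightarrow> 'b" where
    \<phi>: "\<forall>x\<in>{..<4}. \<phi> x \<subseteq> verts G \<and> connected_graph (induced G (\<phi> x))"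
      "\<forall>x\<in>{..<4}. \<forall>y\<in>{..<4}. x \<noteq> y \<longrightarrow> \<phi> x \<inter> \<phi> y = {}"
    and \<psi>: "\<psi> ` edges (complete_graph 4) \<subseteq> edges G"
      "\<forall>e\<in>edges (complete_graph 4). \<forall>x y. e = {x, y} \<longrightarrow>
        (\<exists>u\<in>\<phi> x. \<exists>v\<in>\<phi> y. ends G (\<psi> e) = {u, v})"
    unfolding is_minor_def by (auto simp: complete_graph_def)
  have "K4_model (adj_rel G) \<phi>"
    unfolding K4_model_def
  proof (intro conjI allI impI)
    show "conn (adj_rel G) (\<phi> i)" if "i < 4" for i
      using \<phi>(1) that connected_induced by (metis lessThan_iff)
    fix i j :: nat assume ij: "i < 4" "j < 4" "i \<noteq> j"
    then show "\<phi> i \<inter> \<phi> j = {}" using \<phi>(2) by simp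
    have e: "{i, j} \<in> edges (complete_graph 4)" using ij by (simp add: complete_graph_def)
    then have "\<psi> {i, j} \<in> edges G" using \<psi>(1) by blast
    moreover have "\<exists>u\<in>\<phi> i. \<exists>v\<in>\<phi> j. ends G (\<psi> {i, j}) = {u, v}"
      using bspec[OF \<psi>(2) e] by blast
    ultimately show "touch (adj_rel G) (\<phi> i) (\<phi> j)"
      unfolding touch_def adj_rel_def adj_def by blast
  qed
  then show "K4 (adj_rel G)" by (auto simp: K4_def)
next
  assume "K4 (adj_rel G)"
  then obtain B where B: "K4_model (adj_rel G) B" by (auto simp: K4_def)
  let ?K = "complete_graph 4"
  have sub: "B i \<subseteq> verts G" if "i < 4" for i
    using K4_model_Field[OF B that] adj_verts[OF assms]
    by (auto simp: Field_def adj_rel_def)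
  have disj: "B i \<inter> B j = {}" if "i < 4" "j < 4" "i \<noteq> j" for i j
    using B that by (simp add: K4_model_def)
  have ends: "ends ?K e = e" for e by (simp add: complete_graph_def)
  have edge: "i < 4 \<and> j < 4 \<and> i \<noteq> j" if "{i, j} \<in> edges ?K" for i j
    using that by (auto simp: complete_graph_def card_insert_if split: if_splits)
  have "\<exists>f. f \<in> edges G \<and> (\<forall>i j. e = {i, j} \<longrightarrow> (\<exists>u\<in>B i. \<exists>v\<in>B j. ends G f = {u, v}))"
    if e: "e \<in> edges ?K" for e
  proof -
    have "card e = 2" using e by (simp add: complete_graph_def)
    then obtain i j where ij: "e = {i, j}" by (auto simp: card_2_iff)
    then have "touch (adj_rel G) (B i) (B j)"
      using edge e B by (auto simp: K4_model_def)
    then obtain u v f where f: "u \<in> B i" "v \<in> B j" "f \<in> edges G" "ends G f = {u, v}"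
      by (auto simp: touch_def adj_rel_def adj_def)
    \<comment> \<open>\<open>is_minor\<close> quantifies over both ways of writing an edge as a
      pair.\<close>
    then have "ends G f = {v, u}" by (simp add: insert_commute)
    then show ?thesis using f ij by (auto simp: doubleton_eq_iff)
  qed
  then obtain \<psi> where \<psi>: "\<And>e. e \<in> edges ?K \<Longrightarrow> \<psi> e \<in> edges G"
    "\<And>e i j. e \<in> edges ?K \<Longrightarrow> e = {i, j} \<Longrightarrow> \<exists>u\<in>B i. \<exists>v\<in>B j. ends G (\<psi> e) = {u, v}"
    by metis
  \<comment> \<open>The branch sets met by the ends of \<open>\<psi> e\<close> determine
    \<open>e\<close>, which yields injectivity.\<close>
  have mem: "k \<in> e \<longleftrightarrow> B k \<inter> ends G (\<psi> e) \<noteq> {}" if e: "e \<in> edges ?K" "k < 4" for e k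
  proof -
    have "card e = 2" using e by (simp add: complete_graph_def)
    then obtain i j where ij: "e = {i, j}" by (auto simp: card_2_iff)
    obtain u v where "u \<in> B i" "v \<in> B j" "ends G (\<psi> e) = {u, v}"
      using \<psi>(2)[OF e(1) ij] by blast
    moreover have "i < 4" "j < 4" using edge e ij by auto
    ultimately show ?thesis
      using disj[of k i] disj[of k j] e(2) ij by auto
  qed
  have "inj_on \<psi> (edges ?K)"
  proof (rule inj_onI)
    fix e e' assume e: "e \<in> edges ?K" "e' \<in> edges ?K" "\<psi> e = \<psi> e'"
    then have "e \<subseteq> {..<4}" "e' \<subseteq> {..<4}" by (auto simp: complete_graph_def)
    moreover have "k \<in> e \<longleftrightarrow> k \<in> e'" if "k < 4" for k using mem that e by simp
    ultimately show "e = e'" by blast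
  qed
  moreover have "connected_graph (induced G (B i))" if "i < 4" for i
    using connected_induced[OF sub[OF that]] B that by (simp add: K4_model_def)
  moreover have "verts ?K = {..<4}" by (simp add: complete_graph_def)
  ultimately show "has_K4_minor G"
    unfolding is_minor_def ends
    using sub disj \<psi> by (intro exI[of _ B] exI[of _ \<psi>]) auto
qed

lemma multigraph_induced: "multigraph G \<Longrightarrow> multigraph (induced G X)"
  by (auto simp: multigraph_def induced_def)

lemma K4_minor_induced:
  "multigraph G \<Longrightarrow> has_K4_minor (induced G X) \<longleftrightarrow> K4 (within (adj_rel G) X)"
  using has_K4_minor_iff[OF multigraph_induced] by (simp add: adj_rel_induced)

text \<open>A vertex of the block does not separate \<open>a\<close> from \<open>b\<close>, as it is
  no cut vertex; a vertex outside the block lies on no walk inside it.\<close>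

lemma block_inseparable:
  assumes "block G B" "a \<in> verts B" "b \<in> verts B" "a \<noteq> b"
  shows "inseparable (adj_rel G) a b"
proof -
  have B: "subgraph B G" "connected_graph B" "\<And>c. \<not> cut_vertex B c"
    using assms(1) by (auto simp: block_def)
  have sub: "adj_rel B \<subseteq> adj_rel G"
    using B(1) by (fastforce simp: subgraph_def adj_rel_def adj_def)
  have path: "(a, b) \<in> (adj_rel B)\<^sup>*"
    using B(2) assms by (simp add: connected_graph_def adj_rtranclp)
  have "(a, b) \<in> (within (adj_rel B) (- {c}))\<^sup>*" if "c \<noteq> a" "c \<noteq> b" for c
  proof (cases "c \<in> verts B")
    case True
    then have "(a, b) \<in> (within (adj_rel B) (verts B - {c}))\<^sup>*"
      using B(3)[of c] assms that path
      unfolding cut_vertex_def delete_verts_def adj_rtranclp adj_rel_induced by blast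
    then show ?thesis by (rule within_rtrancl_mono) auto
  next
    case False
    have "multigraph B" using B(1) by (simp add: subgraph_def)
    then have "within (adj_rel B) (- {c}) = adj_rel B"
      using False adj_verts by (fastforce simp: within_def adj_rel_def)
    then show ?thesis using path by simp
  qed
  then show ?thesis
    unfolding inseparable_def
    using assms(4) path rtrancl_mono[OF sub] within_rtrancl_mono[OF _ sub order_refl] by blast
qed

section \<open>Subdividing an edge and suppressing a vertex of degree two\<close>

definition star :: "'v \<Rightarrow> 'v \<Rightarrow> 'v \<Rightarrow> ('v \<times> 'v) set" where
  "star v a b = both_ways v a \<union> both_ways v b"

text \<open>The graph is a 2-sum, along the edge \<open>ab\<close>, of \<open>E\<close> and the
  triangle on \<open>v\<close>, \<open>a\<close> and \<open>b\<close>, and the triangle has too few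
  vertices for a model.\<close>

lemma K4_suppress:
  assumes "v \<notin> Field E" "(a, b) \<in> E" "(b, a) \<in> E" "K4 (E \<union> star v a b)"
  shows "K4 E"
proof -
  let ?E = "E \<union> star v a b"
  have "v \<noteq> a" "v \<noteq> b" using assms(1-3) by (auto simp: Field_def)
  have "K4 (within ?E {v, a, b}) \<or> K4 (within ?E (- {v}))"
    by (rule K4_two_sum[of _ _ _ a b])
      (use assms \<open>v \<noteq> a\<close> \<open>v \<noteq> b\<close> in \<open>auto simp: star_def both_ways_def Field_def\<close>)
  moreover have "\<not> K4 (within ?E {v, a, b})"
    by (rule K4_needs_four_vertices[of _ v a b]) (auto simp: within_def)
  moreover have "within ?E (- {v}) \<subseteq> E" by (auto simp: within_def star_def both_ways_def)
  ultimately show ?thesis using K4_mono by blast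
qed

text \<open>The connected set replacing the edge \<open>ab\<close> is the single vertex
  \<open>v\<close>. Together with \<open>K4_suppress\<close> this allows vertices of
  \<open>F\<close> and virtual edges to be exchanged.\<close>

lemma K4_subdivide:
  assumes "sym E" "v \<notin> Field E" "v \<noteq> a" "v \<noteq> b" "K4 (E \<union> both_ways a b)"
  shows "K4 (E \<union> star v a b)"
proof (rule K4_replace_edge[of _ E a b "{v}"])
  show "sym (E \<union> star v a b)"
    unfolding star_def using assms(1) by (intro sym_Un sym_both_ways)
qed (use assms conn_singleton in \<open>auto simp: touch_def star_def both_ways_def\<close>)

text \<open>If \<open>F\<close> is empty, condition (d) is vacuous and the empty \<open>W\<close> is
  a vertex cover; the assumption that \<open>G[S]\<close> has no \<open>K4\<close> minor then
  supplies the left-hand side.\<close>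

theorem theorem3:
  fixes G :: "('v, 'e) mgraph" and S W :: "'v set"
  assumes "multigraph G"
    and "S \<subseteq> verts G"
    and "independent_pair G S"
    and "\<not> has_K4_minor (induced G S)"
    and "W \<subseteq> verts G - S"
  shows "\<not> has_K4_minor (delete_verts G W) \<longleftrightarrow> vertex_cover (conflict_graph G S) W"
proof -
  let ?R = "adj_rel G" and ?F = "verts G - S"
  let ?H = "within ?R S"
  have ind: "\<not> adj G u v" if "u \<in> ?F" "v \<in> ?F" for u v
    using assms(3) that by (simp add: independent_pair_def independent_set_def Let_def)
  have "\<exists>a b. a \<noteq> b \<and> neighbours G v \<inter> S = {a, b}" if "v \<in> ?F" for v
  proof -
    have "card (neighbours G v \<inter> S) = 2"
      using assms(3) that by (simp add: independent_pair_def Let_def)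
    then show ?thesis by (auto simp: card_2_iff)
  qed
  then obtain l r where lr: "\<And>v. v \<in> ?F \<Longrightarrow> l v \<noteq> r v"
      "\<And>v. v \<in> ?F \<Longrightarrow> neighbours G v \<inter> S = {l v, r v}"
    by metis
  have lrS: "l v \<in> S" "r v \<in> S" if "v \<in> ?F" for v using lr(2)[OF that] by auto
  have insep: "inseparable ?H (l v) (r v)" if v: "v \<in> ?F" for v
  proof -
    have "\<forall>v\<in>?F. \<exists>B. block (induced G S) B \<and> neighbours G v \<inter> S \<subseteq> verts B"
      using assms(3) by (simp add: independent_pair_def Let_def)
    from bspec[OF this v] obtain B where "block (induced G S) B" "{l v, r v} \<subseteq> verts B"
      unfolding lr(2)[OF v] by blast
    then show ?thesis
      using block_inseparable[of "induced G S" B "l v" "r v"] lr(1)[OF v]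
      by (simp add: adj_rel_induced)
  qed
  \<comment> \<open>\<open>F\<close> is independent, so a new vertex \<open>v\<close> brings no
    edges except those to its two neighbours in \<open>S\<close>.\<close>
  have step: "within ?R (S \<union> insert v U) = within ?R (S \<union> U) \<union> star v (l v) (r v)"
    if "insert v U \<subseteq> ?F" for v U
  proof -
    have nb: "(v, u) \<in> ?R \<longleftrightarrow> u = l v \<or> u = r v" if "u \<in> S \<union> insert v U" for u
    proof (cases "u \<in> S")
      case True
      then have "(v, u) \<in> ?R \<longleftrightarrow> u \<in> neighbours G v \<inter> S"
        by (simp add: adj_rel_def neighbours_def)
      then show ?thesis using lr(2)[of v] \<open>insert v U \<subseteq> ?F\<close> by auto
    next
      case False
      then have "u \<in> ?F" "v \<in> ?F" using that \<open>insert v U \<subseteq> ?F\<close> by auto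
      then show ?thesis using ind lrS False by (auto simp: adj_rel_def)
    qed
    have nb': "(u, v) \<in> ?R \<longleftrightarrow> u = l v \<or> u = r v" if "u \<in> S \<union> insert v U" for u
      using nb[OF that] sym_adj_rel by (metis symD)
    have lrv: "l v \<in> S" "r v \<in> S" using lrS that by auto
    show ?thesis
    proof (intro subset_antisym subrelI)
      fix p q assume "(p, q) \<in> within ?R (S \<union> insert v U)"
      then have pq: "(p, q) \<in> ?R" "p \<in> S \<union> insert v U" "q \<in> S \<union> insert v U"
        by (auto simp: within_def)
      consider "p = v" | "q = v" | "p \<noteq> v" "q \<noteq> v" by blast
      then show "(p, q) \<in> within ?R (S \<union> U) \<union> star v (l v) (r v)"
      proof cases
        case 1
        then show ?thesis using pq nb by (auto simp: star_def both_ways_def)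
      next
        case 2
        then show ?thesis using pq nb' by (auto simp: star_def both_ways_def)
      qed (use pq in \<open>auto simp: within_def\<close>)
    next
      fix p q assume "(p, q) \<in> within ?R (S \<union> U) \<union> star v (l v) (r v)"
      then show "(p, q) \<in> within ?R (S \<union> insert v U)"
        using nb[of "l v"] nb[of "r v"] nb'[of "l v"] nb'[of "r v"] lrv
        by (auto simp: within_def star_def both_ways_def)
    qed
  qed
  let ?U = "?F - W"
  \<comment> \<open>Only the vertices that survive the deletion of \<open>W\<close> contribute
    virtual edges.\<close>
  define M where "M = (\<Union>v\<in>?U. both_ways (l v) (r v))"
  have delete: "has_K4_minor (delete_verts G W) \<longleftrightarrow> K4 (within ?R (S \<union> ?U))"
  proof -
    have "verts G - W = S \<union> ?U" using assms(2,5) by blast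
    then show ?thesis by (simp add: delete_verts_def K4_minor_induced[OF assms(1)])
  qed
  show ?thesis
  proof
    assume free: "\<not> has_K4_minor (delete_verts G W)"
    show "vertex_cover (conflict_graph G S) W"
      unfolding vertex_cover_def
    proof (intro conjI ballI notI)
      show "W \<subseteq> verts (conflict_graph G S)" using assms(5) by (simp add: conflict_graph_def)
      fix e assume "e \<in> edges (conflict_graph G S)" "ends (conflict_graph G S) e \<inter> W = {}"
      then obtain u v where uv: "u \<in> ?U" "v \<in> ?U" "has_K4_minor (induced G (S \<union> {u, v}))"
        by (auto simp: conflict_graph_def)
      then have "within ?R (S \<union> {u, v}) \<subseteq> within ?R (S \<union> ?U)" by (intro within_mono) auto
      then show False
        using uv free K4_mono unfolding delete K4_minor_induced[OF assms(1)] by blast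
    qed
  next
    assume cover: "vertex_cover (conflict_graph G S) W"
    \<comment> \<open>For \<open>u = v\<close> this rests on condition (d). Otherwise subdividing
      both virtual edges would make \<open>{u, v}\<close> an edge of the conflict graph missed by
      \<open>W\<close>.\<close>
    have compat: "\<not> K4 (?H \<union> both_ways (l u) (r u) \<union> both_ways (l v) (r v))"
      if uv: "u \<in> ?U" "v \<in> ?U" for u v
    proof
      assume K: "K4 (?H \<union> both_ways (l u) (r u) \<union> both_ways (l v) (r v))"
      have fin: "u \<in> ?F" "v \<in> ?F" using uv by auto
      note S = lrS[OF fin(1)] lrS[OF fin(2)]
      have sym_H: "sym ?H" by (intro sym_within sym_adj_rel)
      have Gu: "within ?R (S \<union> {u}) = ?H \<union> star u (l u) (r u)"
        using step[of u "{}"] fin by simp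
      have Guv: "within ?R (S \<union> {u, v}) = within ?R (S \<union> {u}) \<union> star v (l v) (r v)"
        using step[of v "{u}"] fin by (simp add: insert_commute)
      show False
      proof (cases "u = v")
        case True
        then have "K4 (?H \<union> both_ways (l u) (r u))" using K by (simp add: Un_assoc)
        then have "K4 (?H \<union> star u (l u) (r u))"
          by (rule K4_subdivide[OF sym_H, rotated 3])
            (use fin S in \<open>auto simp: within_def Field_def\<close>)
        then have "has_K4_minor (induced G (S \<union> {u}))"
          unfolding K4_minor_induced[OF assms(1)] Gu .
        then show False using assms(3) fin by (simp add: independent_pair_def Let_def)
      next
        case False
        have sym: "sym (?H \<union> both_ways (l v) (r v))" "sym (?H \<union> star u (l u) (r u))"
          unfolding star_def by (intro sym_Un sym_H sym_both_ways)+
        have "K4 ((?H \<union> both_ways (l v) (r v)) \<union> both_ways (l u) (r u))"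
          using K by (simp add: Un_ac)
        then have "K4 ((?H \<union> both_ways (l v) (r v)) \<union> star u (l u) (r u))"
          by (rule K4_subdivide[OF sym(1), rotated 3])
            (use fin S in \<open>auto simp: within_def Field_def both_ways_def\<close>)
        then have "K4 ((?H \<union> star u (l u) (r u)) \<union> both_ways (l v) (r v))"
          by (simp add: Un_ac)
        then have "K4 ((?H \<union> star u (l u) (r u)) \<union> star v (l v) (r v))"
          by (rule K4_subdivide[OF sym(2), rotated 3])
            (use fin S False in \<open>auto simp: within_def Field_def both_ways_def star_def\<close>)
        then have "has_K4_minor (induced G (S \<union> {u, v}))"
          unfolding K4_minor_induced[OF assms(1)] Guv Gu .
        then have "{u, v} \<in> edges (conflict_graph G S)"
          using fin False by (auto simp: conflict_graph_def)
        then show False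
          using cover uv by (auto simp: vertex_cover_def conflict_graph_def)
      qed
    qed
    have "\<not> K4 (?H \<union> M)"
    proof (rule K4_free_virtual_edges)
      have "?H \<subseteq> verts G \<times> verts G"
        using adj_verts[OF assms(1)] by (auto simp: within_def adj_rel_def)
      then show "finite ?H"
        using assms(1) by (meson finite_SigmaI finite_subset multigraph_def)
      show "sym ?H" by (intro sym_within sym_adj_rel)
      show "(x, x) \<notin> ?H" for x
        using adj_verts[OF assms(1)] by (auto simp: within_def adj_rel_def)
      show "sym M" unfolding M_def by (auto simp: sym_def both_ways_def)
      show "\<not> K4 ?H" using assms(4) by (simp add: K4_minor_induced[OF assms(1)])
      have comm: "both_ways p q = both_ways q p" for p q :: 'v by (auto simp: both_ways_def)
      have M: "\<exists>v\<in>?U. both_ways p q = both_ways (l v) (r v)" if "(p, q) \<in> M" for p q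
        using that by (auto simp: M_def both_ways_def)
      show "\<not> K4 (?H \<union> both_ways p q \<union> both_ways r' s)" if "(p, q) \<in> M" "(r', s) \<in> M"
        for p q r' s
        using M[OF that(1)] M[OF that(2)] compat by metis
      have insep_sym: "inseparable ?H q p" if "inseparable ?H p q" for p q
        using that unfolding inseparable_def
        by (metis sym_rtranclD sym_within sym_adj_rel)
      show "inseparable ?H p q" if "(p, q) \<in> M" for p q
        using that insep insep_sym by (auto simp: M_def both_ways_def)
    qed
    \<comment> \<open>The vertices of \<open>T\<close> are suppressed one by one. Keeping all of
      \<open>M\<close> provides the edge between the two neighbours that \<open>K4_suppress\<close>
      requires.\<close>
    moreover have "K4 (?H \<union> M)" if "finite T" "T \<subseteq> ?U" "K4 (within ?R (S \<union> T) \<union> M)" for T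
      using that
    proof (induction T rule: finite_induct)
      case (insert v T)
      have v: "v \<in> ?F" "v \<in> ?U" using insert.prems by auto
      let ?E = "within ?R (S \<union> T) \<union> M"
      have "v \<notin> Field ?E"
      proof -
        have "Field M \<subseteq> S" using lrS by (auto simp: M_def both_ways_def Field_def)
        moreover have "Field (within ?R (S \<union> T)) \<subseteq> S \<union> T" by (auto simp: within_def Field_def)
        ultimately show ?thesis using v insert.hyps by (auto simp: Field_Un)
      qed
      moreover have "(l v, r v) \<in> ?E" "(r v, l v) \<in> ?E"
        using v by (auto simp: M_def both_ways_def)
      moreover have "K4 (?E \<union> star v (l v) (r v))"
      proof -
        have "insert v T \<subseteq> ?F" using insert.prems by blast
        from step[OF this] show ?thesis using insert.prems(2) by (simp add: Un_ac)
      qed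
      ultimately have "K4 ?E" by (rule K4_suppress)
      then show ?case using insert by blast
    qed simp
    moreover have "finite ?U" using assms(1) by (simp add: multigraph_def)
    ultimately show "\<not> has_K4_minor (delete_verts G W)"
      unfolding delete by (meson K4_mono Un_upper1 order_refl)
  qed
qed

end
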